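(* Let $n\ge 2$ be an integer, let $L_p$ be the Laguerre iteration function of the polynomial $p_n(z)=z^n-1$, and let $\alpha=2\pi/n$. Then $L_p$ commutes with the rotation $T_\alpha(z)=e^{i\alpha}z$ by the angle $\alpha$ about the origin; that is, $L_p(e^{i\alpha}z)=e^{i\alpha}L_p(z)$ for every $z$ in the domain of $L_p$.
   Context: $\sqrt{w}$ denotes the principal square root: if $w=\rho e^{i\phi}$ with $\rho>0$ and $-\pi<\phi\le\pi$, then $\sqrt{w}=\sqrt{\rho}\,e^{i\phi/2}$. For an integer $n\ge2$, the Laguerre iteration function of $p_n(z)=z^n-1$ is $$L_p(z)=z\,\frac{\frac{1}{\sqrt{z^n}}+(n-1)}{\sqrt{z^n}+(n-1)},\qquad z\in\mathbb{C}\setminus\{0\}.$$ For $n\ge3$ it is extended to the extended complex plane $\hat{\mathbb{C}}=\mathbb{C}\cup\{\infty\}$ by $L_p(0)=\infty$ and $L_p(\infty)=0$ (with $e^{i\alpha}\cdot 0=0$ and $e^{i\alpha}\cdot\infty=\infty$). Thus the domain of $L_p$ is $\hat{\mathbb{C}}$ for $n\ge 3$ and $\mathbb{C}\setminus\{0\}$ for $n=2$. *)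

theory Defs
  imports Complex_Main
begin

text \<open>The extended complex plane as a one-point extension, in the style of the library's
  Alexandroff compactification: \<open>None\<close> is the point at infinity and \<open>Some z\<close> the
  finite point \<open>z\<close>.\<close>

type_synonym ext_complex = "complex option"

text \<open>The library's \<open>csqrt\<close> is the principal branch, with \<open>csqrt (-1) = \<i>\<close>. For
  \<open>z \<noteq> 0\<close> and \<open>n \<ge> 2\<close> both divisions are proper, because \<open>csqrt\<close> takes values in the
  closed right half-plane.\<close>

definition laguerre_finite :: "nat \<Rightarrow> complex \<Rightarrow> complex" where
  "laguerre_finite n z =
     z * ((1 / csqrt (z ^ n) + (of_nat n - 1)) / (csqrt (z ^ n) + (of_nat n - 1)))"

definition laguerre_domain :: "nat \<Rightarrow> ext_complex set" where
  "laguerre_domain n = (if n \<ge> 3 then UNIV else Some ` (UNIV - {0}))"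

text \<open>Outside \<open>laguerre_domain n\<close> (relevant only for \<open>n < 3\<close>) the value is unspecified.\<close>

definition laguerre :: "nat \<Rightarrow> ext_complex \<Rightarrow> ext_complex" where
  "laguerre n w =
     (if w \<in> laguerre_domain n then
        (case w of
           None \<Rightarrow> Some 0
         | Some z \<Rightarrow> if z = 0 then None else Some (laguerre_finite n z))
      else undefined)"

text \<open>The rotation about the origin fixes \<open>0\<close> and infinity.\<close>

definition rotation :: "real \<Rightarrow> ext_complex \<Rightarrow> ext_complex" where
  "rotation \<alpha> = map_option (\<lambda>z. exp (\<i> * of_real \<alpha>) * z)"

end

theory Submission
  imports Defs
begin

text \<open>The factor multiplying \<open>z\<close> in \<open>laguerre_finite n z\<close> depends on \<open>z\<close> only through \<open>z ^ n\<close>.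
  Rotation by \<open>2 * pi / n\<close> multiplies \<open>z\<close> by an \<open>n\<close>-th root of unity and so leaves \<open>z ^ n\<close>
  unchanged exactly; the branch of the square root is therefore evaluated at the same point
  before and after the rotation, and its cut causes no trouble. Only the outer factor \<open>z\<close>
  feels the rotation. When \<open>n \<ge> 3\<close>, the points \<open>0\<close> and infinity are fixed by the rotation and
  interchanged by the Laguerre function, so that there both orders of composition give the same point.\<close>

lemma exp_full_turn_div_power:
  fixes n :: nat
  assumes "n > 0"
  shows "exp (\<i> * of_real (2 * pi / real n)) ^ n = 1"
proof -
  have "exp (\<i> * of_real (2 * pi / real n)) ^ n
      = exp (of_nat n * (\<i> * of_real (2 * pi / real n)))"
    by (rule exp_of_nat_mult [symmetric])
  also have "of_nat n * (\<i> * of_real (2 * pi / real n)) = 2 * of_real pi * \<i>"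
    using assms by simp
  finally show ?thesis by simp
qed

lemma laguerre_finite_mult_root_of_unity:
  assumes "c ^ n = 1"
  shows "laguerre_finite n (c * z) = c * laguerre_finite n z"
  using assms by (simp add: laguerre_finite_def power_mult_distrib)

lemma rotation_in_laguerre_domain:
  assumes "w \<in> laguerre_domain n"
  shows "rotation \<alpha> w \<in> laguerre_domain n"
  using assms by (auto simp: laguerre_domain_def rotation_def split: if_splits)

theorem proposition3p1:
  fixes n :: nat and \<alpha> :: real and w :: ext_complex
  assumes "n \<ge> 2"
    and "\<alpha> = 2 * pi / real n"
    and "w \<in> laguerre_domain n"
  shows "rotation \<alpha> w \<in> laguerre_domain n \<and>
         laguerre n (rotation \<alpha> w) = rotation \<alpha> (laguerre n w)"
proof
  show dom: "rotation \<alpha> w \<in> laguerre_domain n"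
    using assms(3) by (rule rotation_in_laguerre_domain)
  have root: "exp (\<i> * of_real \<alpha>) ^ n = 1"
    unfolding assms(2) using assms(1) by (intro exp_full_turn_div_power) simp
  show "laguerre n (rotation \<alpha> w) = rotation \<alpha> (laguerre n w)"
  proof (cases w)
    case None
    with dom assms(3) show ?thesis
      by (simp add: laguerre_def rotation_def)
  next
    case (Some z)
    with dom assms(3) show ?thesis
      by (simp add: laguerre_def rotation_def laguerre_finite_mult_root_of_unity [OF root])
  qed
qed

end
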